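(* Let $n\ge d\ge 1$, let $U\in\mathbb{R}^{n\times d}$ have orthonormal columns, let $\varepsilon\in(0,1)$ and $\delta\in(0,1)$. Let $m$ be a positive integer with $m \ge \delta^{-1}(d^2+d)/(2\varepsilon-\varepsilon^2)^2$. Let $h:[n]\to[m]$ be a random pairwise independent hash function and $\sigma:[n]\to\{-1,1\}$ a random $4$-wise independent hash function (chosen independently), and let $\Pi\in\mathbb{R}^{m\times n}$ be the matrix with $\Pi_{h(j),j}=\sigma(j)$ for each $j\in[n]$ and all other entries $0$ (so $\Pi$ has exactly one non-zero entry per column). Then with probability at least $1-\delta$, all singular values of $\Pi U$ lie in $[1-\varepsilon,1+\varepsilon]$.
   Context: A hash family is $k$-wise independent if the values at any $k$ distinct inputs are independent and each is uniformly distributed on the range. The singular values of a matrix $B$ are the square roots of the eigenvalues of $B^*B$. *)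

theory Defs
  imports "HOL-Probability.Probability" "Jordan_Normal_Form.Schur_Decomposition"
begin

text \<open>
  The values at any k distinct inputs are independent and uniform on R. Asking this for
  every set of at most k inputs is the same thing when A has at least k elements (subfamilies
  of independent families are independent), and it keeps the condition from being vacuous
  when A has fewer than k elements: the values are then fully independent and uniform.
  Measurability of each value, and the fact that it lies in R on the whole sample space,
  are part of indep_vars (singletons J).
\<close>

definition k_wise_independent_hash ::
    "'w measure \<Rightarrow> nat \<Rightarrow> 'a set \<Rightarrow> 'b set \<Rightarrow> ('a \<Rightarrow> 'w \<Rightarrow> 'b) \<Rightarrow> bool" where
  "k_wise_independent_hash M k A R H \<longleftrightarrow>
     (\<forall>J. J \<subseteq> A \<and> finite J \<and> card J \<le> k \<longrightarrow>
        prob_space.indep_vars M (\<lambda>_. count_space R) H J \<and>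
        (\<forall>x\<in>J. distr M (count_space R) (H x) = uniform_count_measure R))"

text \<open>
  The tuples of all hash values are independent as random elements of the respective
  product spaces, i.e. the sigma-algebras they generate on the sample space are independent;
  this is stronger than pairwise independence of H x and G y. (The library's indep_var needs
  both random variables to have the same value type.)
\<close>

definition independent_hashes ::
    "'w measure \<Rightarrow> 'a set \<Rightarrow> 'b set \<Rightarrow> ('a \<Rightarrow> 'w \<Rightarrow> 'b) \<Rightarrow> 'c set \<Rightarrow> ('a \<Rightarrow> 'w \<Rightarrow> 'c) \<Rightarrow> bool" where
  "independent_hashes M A R H S G \<longleftrightarrow>
     prob_space.indep_set M
       (sets (vimage_algebra (space M) (\<lambda>w. \<lambda>x\<in>A. H x w) (Pi\<^sub>M A (\<lambda>_. count_space R))))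
       (sets (vimage_algebra (space M) (\<lambda>w. \<lambda>x\<in>A. G x w) (Pi\<^sub>M A (\<lambda>_. count_space S))))"

definition sketch_matrix :: "nat \<Rightarrow> nat \<Rightarrow> (nat \<Rightarrow> nat) \<Rightarrow> (nat \<Rightarrow> real) \<Rightarrow> real mat" where
  "sketch_matrix m n h s = Matrix.mat m n (\<lambda>(i, j). if h j = i then s j else 0)"

definition orthonormal_columns :: "real mat \<Rightarrow> bool" where
  "orthonormal_columns U \<longleftrightarrow>
     (\<forall>i < dim_col U. \<forall>j < dim_col U.
        scalar_prod (col U i) (col U j) = (if i = j then 1 else 0))"

text \<open>
  Since \<open>mat_adjoint B * B\<close> is real symmetric and positive semidefinite, all its complex
  eigenvalues are real and nonnegative, so ranging over real eigenvalues loses none and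
  the square roots are genuine. For real matrices \<open>mat_adjoint\<close> is the transpose.
\<close>

definition singular_values :: "real mat \<Rightarrow> real set" where
  "singular_values B = {sqrt k | k. eigenvalue (mat_adjoint B * B) k}"

end

theory Submission
  imports Defs
begin

text \<open>
  Write $B = \Pi U$. Since the columns of $\Pi$ are unit vectors and those of $U$ are orthonormal,
  $(B^T B - I)_{ab} = \sum_{j \ne k} U_{ja} U_{kb} \sigma_j \sigma_k [h_j = h_k]$. In the second
  moment of such a sum, 4-wise independence of the signs leaves only the pairs of ordered pairs
  $(j,k)$, $(p,q)$ that are equal or reversed, and each of these collides with probability $1/m$;
  by orthonormality, the expected squared Frobenius norm of $B^T B - I$ is at most $(d^2 + d)/m$.
  By Markov's inequality this norm is below $2\varepsilon - \varepsilon^2$ with probability at least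
  $1 - \delta$, and it bounds the distance from 1 of every eigenvalue of $B^T B$. Finally,
  $1 - (2\varepsilon - \varepsilon^2) = (1 - \varepsilon)^2$ and
  $1 + (2\varepsilon - \varepsilon^2) \le (1 + \varepsilon)^2$.
\<close>

section \<open>Gram matrix of the sketch and its eigenvalues\<close>

text \<open>For signs \<open>s\<close> and hash values that are valid row indices, this is the
  matrix Pi^T Pi - I: distinct columns of Pi share a nonzero row exactly when their indices collide,
  and the diagonal of squared signs is removed.\<close>

definition collision_sign :: "(nat \<Rightarrow> nat) \<Rightarrow> (nat \<Rightarrow> real) \<Rightarrow> nat \<Rightarrow> nat \<Rightarrow> real" where
  "collision_sign h s j k = (if j \<noteq> k \<and> h j = h k then s j * s k else 0)"

lemma index_mat_adjoint_mult_self: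
  fixes B :: "real mat"
  assumes "a < dim_col B" "b < dim_col B"
  shows "(mat_adjoint B * B) $$ (a, b) = (\<Sum>i<dim_row B. B $$ (i, a) * B $$ (i, b))"
  using assms unfolding mat_adjoint_def
  by (auto simp: scalar_prod_def mat_of_rows_def lessThan_atLeast0 intro!: sum.cong)

lemma index_sketch_matrix_mult:
  assumes "U \<in> carrier_mat n d" "i < m" "a < d"
  shows "(sketch_matrix m n h s * U) $$ (i, a) = (\<Sum>j<n. (if h j = i then s j * U $$ (j, a) else 0))"
  using assms
  by (auto simp: sketch_matrix_def scalar_prod_def lessThan_atLeast0 intro!: sum.cong)

lemma orthonormal_columnsD:
  assumes "orthonormal_columns U" "U \<in> carrier_mat n d" "a < d" "b < d"
  shows "(\<Sum>j<n. U $$ (j, a) * U $$ (j, b)) = (if a = b then 1 else 0)"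
proof -
  have "scalar_prod (col U a) (col U b) = (if a = b then 1 else 0)"
    using assms unfolding orthonormal_columns_def by auto
  moreover have "scalar_prod (col U a) (col U b) = (\<Sum>j<n. U $$ (j, a) * U $$ (j, b))"
    using assms by (auto simp: scalar_prod_def lessThan_atLeast0 intro!: sum.cong)
  ultimately show ?thesis by simp
qed

text \<open>Pi^T Pi is the identity plus the matrix of collision signs. Multiplying by U^T and U
  turns the identity into U^T U = I, which leaves a quadratic form in the columns of U as the
  deviation.\<close>

lemma gram_sketch:
  assumes U: "U \<in> carrier_mat n d" "orthonormal_columns U"
    and h: "\<And>j. j < n \<Longrightarrow> h j < m" and s: "\<And>j. j < n \<Longrightarrow> s j \<in> {-1, 1}"
    and ab: "a < d" "b < d"
  shows "(mat_adjoint (sketch_matrix m n h s * U) * (sketch_matrix m n h s * U)) $$ (a, b) =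
    (if a = b then 1 else 0) + (\<Sum>j<n. \<Sum>k<n. U $$ (j, a) * U $$ (k, b) * collision_sign h s j k)"
proof -
  let ?B = "sketch_matrix m n h s * U"
  have dim: "dim_row ?B = m" "dim_col ?B = d"
    using U by (auto simp: sketch_matrix_def)
  have "(mat_adjoint ?B * ?B) $$ (a, b) = (\<Sum>i<m. ?B $$ (i, a) * ?B $$ (i, b))"
    using index_mat_adjoint_mult_self[of a ?B b] ab dim by simp
  also have "\<dots> = (\<Sum>i<m. (\<Sum>j<n. if h j = i then s j * U $$ (j, a) else 0) *
                        (\<Sum>k<n. if h k = i then s k * U $$ (k, b) else 0))"
    using U(1) ab by (intro sum.cong refl) (simp add: index_sketch_matrix_mult)
  also have "\<dots> = (\<Sum>i<m. \<Sum>j<n. \<Sum>k<n. (if i = h j then (if h j = h k then s j * s k * U $$ (j, a) * U $$ (k, b) else 0) else 0))"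
    unfolding sum_product by (intro sum.cong refl) auto
  also have "\<dots> = (\<Sum>j<n. \<Sum>k<n. \<Sum>i<m. (if i = h j then (if h j = h k then s j * s k * U $$ (j, a) * U $$ (k, b) else 0) else 0))"
    by (subst sum.swap, rule sum.cong[OF refl], rule sum.swap)
  \<comment> \<open>With \<open>i\<close> innermost, only the row \<open>i = h j\<close>
    contributes; it occurs in the sum because \<open>h j < m\<close>.\<close>
  also have "\<dots> = (\<Sum>j<n. \<Sum>k<n. (if h j = h k then s j * s k * U $$ (j, a) * U $$ (k, b) else 0))"
    using h by (intro sum.cong refl) (simp add: sum.delta)
  \<comment> \<open>At \<open>k = j\<close> the squared sign is 1 and is split off as the diagonal;
    \<open>collision_sign\<close> vanishes there.\<close>
  also have "\<dots> = (\<Sum>j<n. \<Sum>k<n. (if k = j then U $$ (j, a) * U $$ (j, b) else 0) +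
      U $$ (j, a) * U $$ (k, b) * collision_sign h s j k)"
    using s by (intro sum.cong refl) (fastforce simp: collision_sign_def)
  also have "\<dots> = (\<Sum>j<n. U $$ (j, a) * U $$ (j, b)) + 
      (\<Sum>j<n. \<Sum>k<n. U $$ (j, a) * U $$ (k, b) * collision_sign h s j k)"
    by (simp add: sum.distrib)
  also have "(\<Sum>j<n. U $$ (j, a) * U $$ (j, b)) = (if a = b then 1 else 0)"
    using U ab by (intro orthonormal_columnsD) auto
  finally show ?thesis .
qed

text \<open>On an eigenvector, \<open>A\<close> minus the identity acts as multiplication by
  \<open>k - 1\<close>. Cauchy-Schwarz in each row bounds its effect by the Frobenius norm, and the
  squared length of the eigenvector cancels.\<close>

lemma eigenvalue_near_one:
  fixes A :: "real mat"
  assumes A: "A \<in> carrier_mat d d" and ev: "eigenvalue A k"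
  shows "(k - 1)\<^sup>2 \<le> (\<Sum>a<d. \<Sum>b<d. (A $$ (a, b) - (if a = b then 1 else 0))\<^sup>2)"
proof -
  obtain v where v: "v \<in> carrier_vec d" "v \<noteq> 0\<^sub>v d" "A *\<^sub>v v = k \<cdot>\<^sub>v v"
    using ev A unfolding eigenvalue_def eigenvector_def by auto
  let ?E = "\<lambda>a b. A $$ (a, b) - (if a = b then 1 else 0)"
  have pos: "(\<Sum>b<d. (v $ b)\<^sup>2) > 0"
  proof -
    obtain b where "b < d" "v $ b \<noteq> 0"
      using v(1,2) by (metis carrier_vecD eq_vecI index_zero_vec)
    then show ?thesis by (intro sum_pos2[of _ b]) auto
  qed
  have row: "(k - 1) * v $ a = (\<Sum>b<d. ?E a b * v $ b)" if "a < d" for a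
  proof -
    have "k * v $ a = (A *\<^sub>v v) $ a" using v that by simp
    also have "\<dots> = (\<Sum>b<d. A $$ (a, b) * v $ b)"
      using A v(1) that by (auto simp: scalar_prod_def lessThan_atLeast0 intro!: sum.cong)
    finally have "k * v $ a = (\<Sum>b<d. A $$ (a, b) * v $ b)" .
    moreover have "(\<Sum>b<d. (if a = b then 1 else 0) * v $ b) = (\<Sum>b<d. if a = b then v $ b else 0)"
      by (intro sum.cong) auto
    ultimately show ?thesis
      using that by (simp add: left_diff_distrib sum_subtractf)
  qed
  have "(k - 1)\<^sup>2 * (\<Sum>b<d. (v $ b)\<^sup>2) = (\<Sum>a<d. (\<Sum>b<d. ?E a b * v $ b)\<^sup>2)"
    unfolding sum_distrib_left by (intro sum.cong refl) (simp add: row[symmetric] power_mult_distrib)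
  also have "\<dots> \<le> (\<Sum>a<d. (\<Sum>b<d. (?E a b)\<^sup>2) * (\<Sum>b<d. (v $ b)\<^sup>2))"
    by (intro sum_mono Cauchy_Schwarz_ineq_sum)
  also have "\<dots> = (\<Sum>a<d. \<Sum>b<d. (?E a b)\<^sup>2) * (\<Sum>b<d. (v $ b)\<^sup>2)"
    by (simp add: sum_distrib_right)
  finally show ?thesis using pos by (simp add: mult_le_cancel_right)
qed

text \<open>The interval for the eigenvalues of B^T B matches the square of
  \<open>1 - \<epsilon>\<close> exactly at the lower end and leaves a slack of 2
  \<open>\<epsilon>\<^sup>2\<close> at the upper end.\<close>

lemma singular_values_subset:
  fixes B :: "real mat"
  assumes B: "B \<in> carrier_mat m d" and \<epsilon>: "0 < \<epsilon>" "\<epsilon> < 1"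
    and F: "(\<Sum>a<d. \<Sum>b<d. ((mat_adjoint B * B) $$ (a, b) - (if a = b then 1 else 0))\<^sup>2) \<le> (2 * \<epsilon> - \<epsilon>\<^sup>2)\<^sup>2"
  shows "singular_values B \<subseteq> {1 - \<epsilon>..1 + \<epsilon>}"
proof
  fix x assume "x \<in> singular_values B"
  then obtain k where k: "x = sqrt k" "eigenvalue (mat_adjoint B * B) k"
    unfolding singular_values_def by auto
  have \<eta>: "0 \<le> 2 * \<epsilon> - \<epsilon>\<^sup>2"
    using \<epsilon> by (simp add: power2_eq_square)
  have "mat_adjoint B * B \<in> carrier_mat d d"
    using B by (auto simp: mat_adjoint_def)
  then have "(k - 1)\<^sup>2 \<le> (2 * \<epsilon> - \<epsilon>\<^sup>2)\<^sup>2"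
    using eigenvalue_near_one k(2) F order_trans by blast
  then have "\<bar>k - 1\<bar> \<le> 2 * \<epsilon> - \<epsilon>\<^sup>2"
    using \<eta> by (simp add: abs_le_square_iff[symmetric])
  then have "(1 - \<epsilon>)\<^sup>2 \<le> k" "k \<le> (1 + \<epsilon>)\<^sup>2"
    using zero_le_power2[of \<epsilon>] unfolding power2_sum power2_diff abs_le_iff
    by (simp_all only: power_one mult_1_right) linarith+
  then show "x \<in> {1 - \<epsilon>..1 + \<epsilon>}"
    unfolding k(1) using \<epsilon> by (auto intro: real_le_rsqrt real_le_lsqrt)
qed

context prob_space
begin

section \<open>Distribution and collisions of hash values\<close>

lemma hash_rv:
  assumes "k_wise_independent_hash M k A R H" "k \<ge> 1" "x \<in> A"
  shows "H x \<in> measurable M (count_space R)"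
proof -
  have "indep_vars (\<lambda>_. count_space R) H {x}"
    using assms unfolding k_wise_independent_hash_def by auto
  then show ?thesis by (auto simp: indep_vars_def)
qed

lemma hash_range:
  assumes "k_wise_independent_hash M k A R H" "k \<ge> 1" "x \<in> A" "\<omega> \<in> space M"
  shows "H x \<omega> \<in> R"
  using measurable_space[OF hash_rv[OF assms(1-3)] assms(4)] by simp

lemma prob_hash_eq:
  assumes H: "k_wise_independent_hash M k A R H" "k \<ge> 1" "x \<in> A"
    and R: "finite R" "i \<in> R"
  shows "prob {\<omega> \<in> space M. H x \<omega> = i} = 1 / card R"
proof -
  have "distr M (count_space R) (H x) = uniform_count_measure R"
    using H unfolding k_wise_independent_hash_def by (auto dest: spec[of _ "{x}"])
  then have "measure (distr M (count_space R) (H x)) {i} = 1 / card R"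
    using R by (simp add: measure_uniform_count_measure)
  moreover have "measure (distr M (count_space R) (H x)) {i} = prob (H x -` {i} \<inter> space M)"
    using R by (intro measure_distr hash_rv[OF H]) auto
  moreover have "H x -` {i} \<inter> space M = {\<omega> \<in> space M. H x \<omega> = i}" by auto
  ultimately show ?thesis by simp
qed

text \<open>A collision is a disjoint union over the common value: there are \<open>card R\<close>
  values, each attained by both inputs with probability 1 over the square of
  \<open>card R\<close>.\<close>

lemma prob_hash_collision:
  assumes H: "k_wise_independent_hash M 2 A R H" and xy: "x \<in> A" "y \<in> A" "x \<noteq> y"
    and R: "finite R" "R \<noteq> {}"
  shows "prob {\<omega> \<in> space M. H x \<omega> = H y \<omega>} = 1 / card R"
proof -
  have meas: "{\<omega> \<in> space M. H z \<omega> = i} \<in> events" if "z \<in> A" for z i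
  proof -
    \<comment> \<open>Intersecting with \<open>R\<close> covers values \<open>i\<close> outside the
      range too: the preimage is unchanged because the hash takes values in
      \<open>R\<close>.\<close>
    have "H z -` ({i} \<inter> R) \<inter> space M \<in> events"
      using hash_rv[OF H _ that] by (rule measurable_sets) auto
    also have "H z -` ({i} \<inter> R) \<inter> space M = {\<omega> \<in> space M. H z \<omega> = i}"
      using hash_range[OF H _ that] by auto
    finally show ?thesis .
  qed
  have ind: "indep_vars (\<lambda>_. count_space R) H {x, y}"
    using H xy unfolding k_wise_independent_hash_def by auto
  have pair: "prob ({\<omega> \<in> space M. H x \<omega> = i} \<inter> {\<omega> \<in> space M. H y \<omega> = i}) = 1 / card R * (1 / card R)"
    if "i \<in> R" for i
  proof -
    have "prob (\<Inter>z\<in>{x, y}. H z -` {i} \<inter> space M) = (\<Prod>z\<in>{x, y}. prob (H z -` {i} \<inter> space M))"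
      using that by (intro indep_varsD_finite[OF ind]) auto
    moreover have "H z -` {i} \<inter> space M = {\<omega> \<in> space M. H z \<omega> = i}" for z by auto
    ultimately show ?thesis
      using xy prob_hash_eq[OF H _ _ R(1) that] by simp
  qed
  have "{\<omega> \<in> space M. H x \<omega> = H y \<omega>} =
      (\<Union>i\<in>R. {\<omega> \<in> space M. H x \<omega> = i} \<inter> {\<omega> \<in> space M. H y \<omega> = i})"
    using hash_range[OF H] xy by auto
  also have "prob \<dots> = (\<Sum>i\<in>R. prob ({\<omega> \<in> space M. H x \<omega> = i} \<inter> {\<omega> \<in> space M. H y \<omega> = i}))"
    using R meas xy by (intro finite_measure_finite_Union) (auto simp: disjoint_family_on_def)
  also have "\<dots> = 1 / card R"
    using R by (simp add: pair)
  finally show ?thesis .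
qed

section \<open>Events determined by tuples of hash values\<close>

text \<open>A finite product of finite discrete spaces is again discrete. Hence every predicate of
  the tuple defines an event, however complicated it is.\<close>

lemma measurable_hash_tuple:
  assumes "k_wise_independent_hash M k A R H" "k \<ge> 1" "finite A" "finite R"
  shows "(\<lambda>\<omega>. \<lambda>x\<in>A. H x \<omega>) \<in> measurable M (count_space (A \<rightarrow>\<^sub>E R))"
proof -
  have "(\<lambda>\<omega>. \<lambda>x\<in>A. H x \<omega>) \<in> measurable M (PiM A (\<lambda>_. count_space R))"
    by (intro measurable_restrict hash_rv[OF assms(1,2)])
  then show ?thesis
    using assms(3,4) by (simp add: count_space_PiM_finite countable_finite)
qed

lemma hash_tuple_event:
  assumes "k_wise_independent_hash M k A R H" "k \<ge> 1" "finite A" "finite R"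
  shows "{\<omega> \<in> space M. P (\<lambda>x\<in>A. H x \<omega>)} \<in> events"
proof -
  have "(\<lambda>\<omega>. \<lambda>x\<in>A. H x \<omega>) -` {f \<in> A \<rightarrow>\<^sub>E R. P f} \<inter> space M \<in> events"
    by (rule measurable_sets[OF measurable_hash_tuple[OF assms]]) auto
  also have "(\<lambda>\<omega>. \<lambda>x\<in>A. H x \<omega>) -` {f \<in> A \<rightarrow>\<^sub>E R. P f} \<inter> space M = {\<omega> \<in> space M. P (\<lambda>x\<in>A. H x \<omega>)}"
    using hash_range[OF assms(1,2)] by auto
  finally show ?thesis .
qed

text \<open>Splitting over the finitely many values of the first tuple leaves a predicate of the
  second one alone. This makes the success event of the theorem measurable without any study of how
  singular values depend on the matrix.\<close>

lemma hash_tuple_pair_event: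
  assumes H: "k_wise_independent_hash M k A R H" "k \<ge> 1"
    and G: "k_wise_independent_hash M l A S G" "l \<ge> 1"
    and fin: "finite A" "finite R" "finite S"
  shows "{\<omega> \<in> space M. P (\<lambda>x\<in>A. H x \<omega>) (\<lambda>x\<in>A. G x \<omega>)} \<in> events"
proof -
  have "(\<lambda>x\<in>A. H x \<omega>) \<in> A \<rightarrow>\<^sub>E R" if "\<omega> \<in> space M" for \<omega>
    using measurable_space[OF measurable_hash_tuple[OF H fin(1,2)] that] by simp
  then have "{\<omega> \<in> space M. P (\<lambda>x\<in>A. H x \<omega>) (\<lambda>x\<in>A. G x \<omega>)} = (\<Union>f\<in>A \<rightarrow>\<^sub>E R.
      {\<omega> \<in> space M. (\<lambda>x\<in>A. H x \<omega>) = f} \<inter> {\<omega> \<in> space M. P f (\<lambda>x\<in>A. G x \<omega>)})"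
    by blast
  also have "\<dots> \<in> events"
    using hash_tuple_event[OF H fin(1,2)] hash_tuple_event[OF G fin(1,3)]
    by (intro sets.finite_UN sets.Int finite_PiE fin)
  finally show ?thesis .
qed

text \<open>All sets of tuples are measurable in the finite product, so both events lie in the
  generated sigma-algebras, where independence yields the product rule.\<close>

lemma prob_indep_hashes:
  assumes H: "k_wise_independent_hash M k A R H" "k \<ge> 1"
    and G: "k_wise_independent_hash M l A S G" "l \<ge> 1"
    and ind: "independent_hashes M A R H S G"
    and fin: "finite A" "finite R" "finite S"
  shows "prob {\<omega> \<in> space M. P (\<lambda>x\<in>A. H x \<omega>) \<and> Q (\<lambda>x\<in>A. G x \<omega>)} =
    prob {\<omega> \<in> space M. P (\<lambda>x\<in>A. H x \<omega>)} * prob {\<omega> \<in> space M. Q (\<lambda>x\<in>A. G x \<omega>)}"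
proof -
  have event: "{\<omega> \<in> space M. P' (\<lambda>x\<in>A. H' x \<omega>)} \<in>
      sets (vimage_algebra (space M) (\<lambda>\<omega>. \<lambda>x\<in>A. H' x \<omega>) (PiM A (\<lambda>_. count_space R')))"
    if H': "k_wise_independent_hash M k' A R' H'" "k' \<ge> 1" and R': "finite R'"
    for k' P' and R' :: "'z set" and H'
  proof -
    have "{f \<in> A \<rightarrow>\<^sub>E R'. P' f} \<in> sets (PiM A (\<lambda>_. count_space R'))"
      using fin R' by (auto simp: count_space_PiM_finite countable_finite)
    from in_vimage_algebra[OF this, of "\<lambda>\<omega>. \<lambda>x\<in>A. H' x \<omega>" "space M"]
    show ?thesis
      using hash_range[OF H'] by (auto simp: vimage_def Int_def conj_commute cong: conj_cong)
  qed
  have "prob ({\<omega> \<in> space M. P (\<lambda>x\<in>A. H x \<omega>)} \<inter> {\<omega> \<in> space M. Q (\<lambda>x\<in>A. G x \<omega>)}) =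
    prob {\<omega> \<in> space M. P (\<lambda>x\<in>A. H x \<omega>)} * prob {\<omega> \<in> space M. Q (\<lambda>x\<in>A. G x \<omega>)}"
    using ind[unfolded independent_hashes_def] event[OF H fin(2)] event[OF G fin(3)]
    by (rule indep_setD)
  moreover have "{\<omega> \<in> space M. P (\<lambda>x\<in>A. H x \<omega>)} \<inter> {\<omega> \<in> space M. Q (\<lambda>x\<in>A. G x \<omega>)} =
    {\<omega> \<in> space M. P (\<lambda>x\<in>A. H x \<omega>) \<and> Q (\<lambda>x\<in>A. G x \<omega>)}" by auto
  ultimately show ?thesis by simp
qed

section \<open>Moments of random signs\<close>

text \<open>A sign equals twice the indicator of the value 1, minus 1. This reduces expectations of
  signs to probabilities of events, the form in which independence of the two hash functions is
  available.\<close>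

lemma expectation_pm_one:
  fixes X :: "'a \<Rightarrow> real"
  assumes pm: "\<And>\<omega>. \<omega> \<in> space M \<Longrightarrow> X \<omega> \<in> {-1, 1}"
    and ev: "{\<omega> \<in> space M. X \<omega> = 1} \<in> events" and A: "A \<in> events"
  shows "integrable M (\<lambda>\<omega>. X \<omega> * indicator A \<omega>)"
    and "expectation (\<lambda>\<omega>. X \<omega> * indicator A \<omega>) = 2 * prob ({\<omega> \<in> space M. X \<omega> = 1} \<inter> A) - prob A"
proof -
  let ?B = "{\<omega> \<in> space M. X \<omega> = 1}"
  have eq: "X \<omega> * indicator A \<omega> = 2 * indicator (?B \<inter> A) \<omega> - indicator A \<omega>" if "\<omega> \<in> space M" for \<omega>
    using pm[OF that] that by (auto simp: indicator_def)
  have ind: "integrable M (indicat_real C)" if "C \<in> events" for C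
    using that by (intro integrable_real_indicator) (auto simp: emeasure_eq_measure)
  have int: "integrable M (\<lambda>\<omega>. 2 * indicator (?B \<inter> A) \<omega> - indicator A \<omega> :: real)"
    using ind ev A
    by (intro Bochner_Integration.integrable_diff integrable_mult_right) auto
  show "integrable M (\<lambda>\<omega>. X \<omega> * indicator A \<omega>)"
    using int by (subst Bochner_Integration.integrable_cong[OF refl eq]) auto
  have "expectation (\<lambda>\<omega>. X \<omega> * indicator A \<omega>) =
      expectation (\<lambda>\<omega>. 2 * indicator (?B \<inter> A) \<omega> - indicator A \<omega>)"
    by (intro Bochner_Integration.integral_cong refl eq)
  also have "\<dots> = 2 * prob (?B \<inter> A) - prob A"
    using ev A ind by (subst Bochner_Integration.integral_diff) auto
  finally show "expectation (\<lambda>\<omega>. X \<omega> * indicator A \<omega>) = 2 * prob (?B \<inter> A) - prob A" .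
qed

lemma expectation_sign_hash:
  fixes s :: "nat \<Rightarrow> 'a \<Rightarrow> real"
  assumes s: "k_wise_independent_hash M k A {-1, 1} s" "k \<ge> 1" "j \<in> A"
  shows "integrable M (s j)" and "expectation (s j) = 0"
proof -
  have ev: "{\<omega> \<in> space M. s j \<omega> = 1} \<in> events"
    using measurable_sets[OF hash_rv[OF s], of "{1}"]
    by (auto simp: vimage_def Int_def conj_commute)
  have pm: "s j \<omega> \<in> {-1, 1}" if "\<omega> \<in> space M" for \<omega>
    using hash_range[OF s that] .
  \<comment> \<open>Choosing the whole space as the event recovers the plain expectation.\<close>
  note e = expectation_pm_one[where X = "s j", OF pm ev sets.top]
  have cong: "s j \<omega> * indicator (space M) \<omega> = s j \<omega>" if "\<omega> \<in> space M" for \<omega>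
    using that by simp
  show "integrable M (s j)"
    using e(1) by (simp cong: Bochner_Integration.integrable_cong)
  have "{\<omega> \<in> space M. s j \<omega> = 1} \<inter> space M = {\<omega> \<in> space M. s j \<omega> = 1}" by auto
  then have "expectation (\<lambda>\<omega>. s j \<omega> * indicator (space M) \<omega>) = 0"
    using e(2) prob_hash_eq[OF s, of 1] by (simp add: prob_space)
  then show "expectation (s j) = 0"
    by (subst (asm) Bochner_Integration.integral_cong[OF refl cong])
qed

text \<open>The product is written with exponents counting the occurrences of each index, so that it
  factors over distinct indices; the index \<open>i\<close> has exponent one and mean zero.\<close>

lemma expectation_four_signs_single:
  fixes s :: "nat \<Rightarrow> 'a \<Rightarrow> real"
  assumes s: "k_wise_independent_hash M 4 A {-1, 1} s"
    and A: "i \<in> A" "j \<in> A" "k \<in> A" "l \<in> A" and single: "i \<notin> {j, k, l}"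
  shows "expectation (\<lambda>\<omega>. s i \<omega> * s j \<omega> * s k \<omega> * s l \<omega>) = 0"
proof -
  let ?J = "{i, j, k, l}"
  define c :: "nat \<Rightarrow> nat" where "c x = of_bool (x = i) + of_bool (x = j) + of_bool (x = k) + of_bool (x = l)" for x
  define Y where "Y = (\<lambda>x \<omega>. s x \<omega> ^ c x)"
  \<comment> \<open>The indices \<open>j\<close>, \<open>k\<close>, \<open>l\<close> may coincide,
    so the independent family can have fewer than four members.\<close>
  have card: "card ?J \<le> 4" by (simp add: card_insert_if)
  have "indep_vars (\<lambda>_. count_space {-1, 1}) s ?J"
    using s[unfolded k_wise_independent_hash_def, rule_format, of ?J] A card by simp
  then have ind: "indep_vars (\<lambda>_. borel) Y ?J"
    unfolding Y_def by (rule indep_vars_compose2) simp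
  have "c i = 1" using single by (auto simp: c_def)
  then have Yi: "Y i = s i" by (simp add: Y_def)
  have int: "integrable M (Y x)" if "x \<in> ?J" for x
  proof (rule integrable_const_bound[where B = 1])
    have "x \<in> A" using that A by auto
    then have "\<bar>s x \<omega>\<bar> = 1" if "\<omega> \<in> space M" for \<omega>
      using hash_range[OF s _ _ that, of x] by auto
    then show "AE \<omega> in M. norm (Y x \<omega>) \<le> 1"
      unfolding Y_def by (intro AE_I2) (simp add: power_abs)
    show "Y x \<in> borel_measurable M"
      using ind that by (auto simp: indep_vars_def)
  qed
  \<comment> \<open>The exponent \<open>c x\<close> is a sum of four indicators, so the product over
    distinct indices splits into four products, each collapsing to one of the original
    factors.\<close>
  have pow: "(\<Prod>x\<in>?J. s x \<omega> ^ of_bool (x = y)) = s y \<omega>" if "y \<in> ?J" for y \<omega>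
  proof -
    have "(\<Prod>x\<in>?J. s x \<omega> ^ of_bool (x = y)) = (\<Prod>x\<in>?J. if x = y then s x \<omega> else 1)"
      by (intro prod.cong) auto
    then show ?thesis using that by (subst (asm) prod.delta) auto
  qed
  have "(\<Prod>x\<in>?J. Y x \<omega>) = s i \<omega> * s j \<omega> * s k \<omega> * s l \<omega>" for \<omega>
    unfolding Y_def c_def power_add prod.distrib by (simp only: pow insert_iff simp_thms)
  then have "expectation (\<lambda>\<omega>. s i \<omega> * s j \<omega> * s k \<omega> * s l \<omega>) = expectation (\<lambda>\<omega>. \<Prod>x\<in>?J. Y x \<omega>)"
    by simp
  also have "\<dots> = (\<Prod>x\<in>?J. expectation (Y x))"
    by (rule indep_vars_lebesgue_integral[OF _ ind int]) auto
  also have "\<dots> = 0"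
    using expectation_sign_hash(2)[OF s, of i] A Yi by (intro prod_zero) auto
  finally show ?thesis .
qed

text \<open>Unless \<open>j\<close> or \<open>k\<close> occurs just once, both lie in the pair
  \<open>p\<close>, \<open>q\<close>, which is then the same pair or its reversal. The product is in
  that case a product of two squared signs. The two indicators on the right exclude each other
  because \<open>j \<noteq> k\<close>.\<close>

lemma expectation_four_signs:
  fixes s :: "nat \<Rightarrow> 'a \<Rightarrow> real"
  assumes s: "k_wise_independent_hash M 4 A {-1, 1} s"
    and A: "j \<in> A" "k \<in> A" "p \<in> A" "q \<in> A" and neq: "j \<noteq> k" "p \<noteq> q"
  shows "expectation (\<lambda>\<omega>. s j \<omega> * s k \<omega> * s p \<omega> * s q \<omega>) =
    of_bool (p = j \<and> q = k) + of_bool (p = k \<and> q = j)"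
proof -
  consider "j \<notin> {k, p, q}" | "k \<notin> {j, p, q}" | "p = j \<and> q = k \<or> p = k \<and> q = j"
    using neq by blast
  then show ?thesis
  proof cases
    case 1
    then show ?thesis using expectation_four_signs_single[OF s A 1] by auto
  next
    case 2
    then show ?thesis
      using expectation_four_signs_single[OF s A(2,1,3,4) 2] by (auto simp: mult.commute)
  next
    case 3
    have "s x \<omega> * s x \<omega> = 1" if "x \<in> A" "\<omega> \<in> space M" for x \<omega>
      using hash_range[OF s _ that] by auto
    then have "s j \<omega> * s k \<omega> * s p \<omega> * s q \<omega> = 1" if "\<omega> \<in> space M" for \<omega>
      using 3 A that by (metis mult.commute mult.left_commute mult_1)
    then have "expectation (\<lambda>\<omega>. s j \<omega> * s k \<omega> * s p \<omega> * s q \<omega>) = expectation (\<lambda>_. 1)"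
      by (intro Bochner_Integration.integral_cong) auto
    then show ?thesis using 3 neq by (auto simp: prob_space)
  qed
qed


section \<open>Second moment of the Gram deviation\<close>

text \<open>The product is a product of four signs times the indicator of two collisions, and
  independence of the two hash functions separates these factors. Where the sign factor has nonzero
  mean, both collisions are the same event, so pairwise independence of \<open>h\<close>
  suffices.\<close>

lemma expectation_collision_signs:
  fixes h :: "nat \<Rightarrow> 'a \<Rightarrow> nat" and s :: "nat \<Rightarrow> 'a \<Rightarrow> real"
  assumes h: "k_wise_independent_hash M 2 {..<n} {..<m} h" and m: "m > 0"
    and s: "k_wise_independent_hash M 4 {..<n} {-1, 1} s"
    and ind: "independent_hashes M {..<n} {..<m} h {-1, 1} s"
    and jk: "j < n" "k < n" and pq: "p < n" "q < n"
  defines "Z \<equiv> \<lambda>j k \<omega>. collision_sign (\<lambda>j. h j \<omega>) (\<lambda>j. s j \<omega>) j k"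
  shows "integrable M (\<lambda>\<omega>. Z j k \<omega> * Z p q \<omega>)"
    and "expectation (\<lambda>\<omega>. Z j k \<omega> * Z p q \<omega>) =
      (if j \<noteq> k then (of_bool (p = j \<and> q = k) + of_bool (p = k \<and> q = j)) / m else 0)"
proof -
  let ?X = "\<lambda>\<omega>. s j \<omega> * s k \<omega> * s p \<omega> * s q \<omega>"
  let ?A = "{\<omega> \<in> space M. h j \<omega> = h k \<omega> \<and> h p \<omega> = h q \<omega>}"
  let ?B = "{\<omega> \<in> space M. ?X \<omega> = 1}"
  let ?P = "\<lambda>f. f j = f k \<and> f p = f q"
  let ?Q = "\<lambda>g. g j * g k * g p * g q = 1"
  have "integrable M (\<lambda>\<omega>. Z j k \<omega> * Z p q \<omega>) \<and> expectation (\<lambda>\<omega>. Z j k \<omega> * Z p q \<omega>) =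
      (if j \<noteq> k then (of_bool (p = j \<and> q = k) + of_bool (p = k \<and> q = j)) / m else 0)"
  proof (cases "j = k \<or> p = q")
    case True
    then have "(\<lambda>\<omega>. Z j k \<omega> * Z p q \<omega>) = (\<lambda>_. 0)"
      by (auto simp: Z_def collision_sign_def)
    \<comment> \<open>If \<open>p = q\<close> while \<open>j \<noteq> k\<close>, neither indicator
      can hold.\<close>
    moreover have "(if j \<noteq> k then (of_bool (p = j \<and> q = k) + of_bool (p = k \<and> q = j)) / m else 0) = (0 :: real)"
      using True by (cases "j = k") auto
    ultimately show ?thesis
      by (metis Bochner_Integration.integrable_zero Bochner_Integration.integral_zero)
  next
    case False
    have A: "?A \<in> events"
      using hash_tuple_event[OF h, of ?P] jk pq by simp
    have B: "?B \<in> events"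
      using hash_tuple_event[OF s, of ?Q] jk pq by simp
    have "prob {\<omega> \<in> space M. ?P (\<lambda>x\<in>{..<n}. h x \<omega>) \<and> ?Q (\<lambda>x\<in>{..<n}. s x \<omega>)} =
        prob {\<omega> \<in> space M. ?P (\<lambda>x\<in>{..<n}. h x \<omega>)} * prob {\<omega> \<in> space M. ?Q (\<lambda>x\<in>{..<n}. s x \<omega>)}"
      by (rule prob_indep_hashes[OF h _ s _ ind]) auto
    moreover have "{\<omega> \<in> space M. ?P (\<lambda>x\<in>{..<n}. h x \<omega>) \<and> ?Q (\<lambda>x\<in>{..<n}. s x \<omega>)} = ?B \<inter> ?A"
      using jk pq by auto
    ultimately have AB: "prob (?B \<inter> ?A) = prob ?A * prob ?B"
      using jk pq by simp
    have pm: "?X \<omega> \<in> {-1, 1}" if "\<omega> \<in> space M" for \<omega>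
      using hash_range[OF s _ _ that, of j] hash_range[OF s _ _ that, of k]
        hash_range[OF s _ _ that, of p] hash_range[OF s _ _ that, of q] jk pq by auto
    note eA = expectation_pm_one[where X = ?X, OF pm B A]
      and e1 = expectation_pm_one(2)[where X = ?X, OF pm B sets.top]
    have "expectation (\<lambda>\<omega>. ?X \<omega> * indicator (space M) \<omega>) = expectation ?X"
      by (intro Bochner_Integration.integral_cong) auto
    then have EX: "expectation ?X = 2 * prob ?B - 1"
      using e1 by (simp add: prob_space Int_absorb2 subset_iff)
    have ZZ: "Z j k \<omega> * Z p q \<omega> = ?X \<omega> * indicator ?A \<omega>" if "\<omega> \<in> space M" for \<omega>
      using False that by (auto simp: Z_def collision_sign_def)
    have "integrable M (\<lambda>\<omega>. Z j k \<omega> * Z p q \<omega>)"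
      using eA(1) by (subst Bochner_Integration.integrable_cong[OF refl ZZ])
    moreover have "expectation (\<lambda>\<omega>. Z j k \<omega> * Z p q \<omega>) = prob ?A * expectation ?X"
    proof -
      have "expectation (\<lambda>\<omega>. Z j k \<omega> * Z p q \<omega>) = expectation (\<lambda>\<omega>. ?X \<omega> * indicator ?A \<omega>)"
        by (rule Bochner_Integration.integral_cong[OF refl ZZ])
      also have "\<dots> = 2 * prob (?B \<inter> ?A) - prob ?A"
        by (rule eA(2))
      also have "\<dots> = prob ?A * expectation ?X"
        unfolding AB EX by (simp add: right_diff_distrib)
      finally show ?thesis .
    qed
    moreover have "expectation ?X = of_bool (p = j \<and> q = k) + of_bool (p = k \<and> q = j)"
      using False jk pq by (intro expectation_four_signs[OF s]) auto
    \<comment> \<open>For all other index pairs the sign expectation is 0, so the probability of the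
      double collision need not be computed.\<close>
    moreover have "prob ?A = 1 / m" if "p = j \<and> q = k \<or> p = k \<and> q = j"
    proof -
      have "?A = {\<omega> \<in> space M. h j \<omega> = h k \<omega>}" using that by auto
      then show ?thesis
        using prob_hash_collision[OF h, of j k] jk m False by auto
    qed
    ultimately show ?thesis using False by auto
  qed
  then show "integrable M (\<lambda>\<omega>. Z j k \<omega> * Z p q \<omega>)"
    and "expectation (\<lambda>\<omega>. Z j k \<omega> * Z p q \<omega>) =
      (if j \<noteq> k then (of_bool (p = j \<and> q = k) + of_bool (p = k \<and> q = j)) / m else 0)"
    by auto
qed

text \<open>After expanding the square, each off-diagonal pair \<open>(j, k)\<close> correlates only
  with itself and with \<open>(k, j)\<close>; these give the two terms of the bound.\<close>

lemma expectation_collision_form_square: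
  fixes h :: "nat \<Rightarrow> 'a \<Rightarrow> nat" and s :: "nat \<Rightarrow> 'a \<Rightarrow> real" and c :: "nat \<Rightarrow> nat \<Rightarrow> real"
  assumes h: "k_wise_independent_hash M 2 {..<n} {..<m} h" and m: "m > 0"
    and s: "k_wise_independent_hash M 4 {..<n} {-1, 1} s"
    and ind: "independent_hashes M {..<n} {..<m} h {-1, 1} s"
  defines "X \<equiv> \<lambda>\<omega>. \<Sum>j<n. \<Sum>k<n. c j k * collision_sign (\<lambda>j. h j \<omega>) (\<lambda>j. s j \<omega>) j k"
  shows "integrable M (\<lambda>\<omega>. (X \<omega>)\<^sup>2)"
    and "expectation (\<lambda>\<omega>. (X \<omega>)\<^sup>2) \<le> (\<Sum>j<n. \<Sum>k<n. (c j k)\<^sup>2 + c j k * c k j) / m"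
proof -
  define Z where "Z j k \<omega> = collision_sign (\<lambda>j. h j \<omega>) (\<lambda>j. s j \<omega>) j k" for j k \<omega>
  note ZZ = expectation_collision_signs[OF h m s ind, folded Z_def]
  have sq: "(X \<omega>)\<^sup>2 = (\<Sum>j<n. \<Sum>p<n. \<Sum>k<n. \<Sum>q<n. c j k * c p q * (Z j k \<omega> * Z p q \<omega>))" for \<omega>
    unfolding X_def Z_def power2_eq_square sum_product by (intro sum.cong refl) (simp add: mult_ac)
  \<comment> \<open>This form delivers integrability and the value of the integral together.\<close>
  have X: "has_bochner_integral M (\<lambda>\<omega>. (X \<omega>)\<^sup>2)
      (\<Sum>j<n. \<Sum>p<n. \<Sum>k<n. \<Sum>q<n. c j k * c p q * expectation (\<lambda>\<omega>. Z j k \<omega> * Z p q \<omega>))"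
    unfolding sq
    by (intro has_bochner_integral_sum has_bochner_integral_mult_right has_bochner_integral_integrable ZZ(1)) auto
  then show "integrable M (\<lambda>\<omega>. (X \<omega>)\<^sup>2)"
    by (rule integrable.intros)
  have "expectation (\<lambda>\<omega>. (X \<omega>)\<^sup>2) =
      (\<Sum>j<n. \<Sum>p<n. \<Sum>k<n. \<Sum>q<n. c j k * c p q * expectation (\<lambda>\<omega>. Z j k \<omega> * Z p q \<omega>))"
    using X by (rule has_bochner_integral_integral_eq)
  also have "\<dots> = (\<Sum>j<n. \<Sum>k<n. \<Sum>p<n. \<Sum>q<n. c j k * c p q * expectation (\<lambda>\<omega>. Z j k \<omega> * Z p q \<omega>))"
    by (intro sum.cong refl sum.swap)
  also have "\<dots> = (\<Sum>j<n. \<Sum>k<n. if j \<noteq> k then ((c j k)\<^sup>2 + c j k * c k j) / m else 0)"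
  proof (intro sum.cong refl)
    fix j k assume jk: "j \<in> {..<n}" "k \<in> {..<n}"
    have "(\<Sum>p<n. \<Sum>q<n. c j k * c p q * expectation (\<lambda>\<omega>. Z j k \<omega> * Z p q \<omega>)) =
        (\<Sum>p<n. \<Sum>q<n. if j \<noteq> k then
          (if p = j then if q = k then c j k * c j k / m else 0 else 0) +
          (if p = k then if q = j then c j k * c k j / m else 0 else 0) else 0)"
      using jk by (intro sum.cong refl) (auto simp: ZZ(2))
    also have "\<dots> = (if j \<noteq> k then ((c j k)\<^sup>2 + c j k * c k j) / m else 0)"
    proof -
      have inner: "(\<Sum>q<n. if p = x then if q = y then z else 0 else 0) = (if p = x then z else 0)"
        if "y < n" for p x y and z :: real
        using that by (auto simp: sum.delta)
      show ?thesis
        using jk by (auto simp: sum.distrib inner sum.delta power2_eq_square add_divide_distrib)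
    qed
    finally show "(\<Sum>p<n. \<Sum>q<n. c j k * c p q * expectation (\<lambda>\<omega>. Z j k \<omega> * Z p q \<omega>)) =
      (if j \<noteq> k then ((c j k)\<^sup>2 + c j k * c k j) / m else 0)" .
  qed
  \<comment> \<open>The diagonal terms put back here equal twice the square of \<open>c j j\<close>,
    over \<open>m\<close>, hence are nonnegative. They complete the sums so that orthonormality can
    be applied.\<close>
  also have "\<dots> \<le> (\<Sum>j<n. \<Sum>k<n. ((c j k)\<^sup>2 + c j k * c k j) / m)"
    by (intro sum_mono) (auto simp: power2_eq_square)
  also have "\<dots> = (\<Sum>j<n. \<Sum>k<n. (c j k)\<^sup>2 + c j k * c k j) / m"
    by (simp only: sum_divide_distrib)
  finally show "expectation (\<lambda>\<omega>. (X \<omega>)\<^sup>2) \<le> (\<Sum>j<n. \<Sum>k<n. (c j k)\<^sup>2 + c j k * c k j) / m" .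
qed

text \<open>For these coefficients the two terms of the moment bound factor: one is the product of
  the squared lengths of columns \<open>a\<close> and \<open>b\<close>, the other the square of
  their inner product. Orthonormality makes them 1 and the Kronecker delta, and summing over
  \<open>a\<close> and \<open>b\<close> gives d^2 + d.\<close>

lemma expectation_gram_deviation:
  fixes h :: "nat \<Rightarrow> 'a \<Rightarrow> nat" and s :: "nat \<Rightarrow> 'a \<Rightarrow> real"
  assumes h: "k_wise_independent_hash M 2 {..<n} {..<m} h" and m: "m > 0"
    and s: "k_wise_independent_hash M 4 {..<n} {-1, 1} s"
    and ind: "independent_hashes M {..<n} {..<m} h {-1, 1} s"
    and U: "U \<in> carrier_mat n d" "orthonormal_columns U"
  defines "F \<equiv> \<lambda>\<omega>. \<Sum>a<d. \<Sum>b<d. (\<Sum>j<n. \<Sum>k<n. U $$ (j, a) * U $$ (k, b) *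
      collision_sign (\<lambda>j. h j \<omega>) (\<lambda>j. s j \<omega>) j k)\<^sup>2"
  shows "integrable M F" and "expectation F \<le> (real d ^ 2 + real d) / m"
proof -
  let ?c = "\<lambda>a b j k. U $$ (j, a) * U $$ (k, b)"
  note X = expectation_collision_form_square[OF h m s ind]
  show "integrable M F"
    unfolding F_def by (intro Bochner_Integration.integrable_sum X(1))
  have "expectation F \<le> (\<Sum>a<d. \<Sum>b<d. (\<Sum>j<n. \<Sum>k<n. (?c a b j k)\<^sup>2 + ?c a b j k * ?c a b k j) / m)"
  proof -
    have "expectation F = (\<Sum>a<d. \<Sum>b<d. expectation (\<lambda>\<omega>. (\<Sum>j<n. \<Sum>k<n. ?c a b j k *
        collision_sign (\<lambda>j. h j \<omega>) (\<lambda>j. s j \<omega>) j k)\<^sup>2))"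
      unfolding F_def by (simp add: X(1))
    then show ?thesis using X(2) by (auto intro!: sum_mono)
  qed
  also have "\<dots> = (\<Sum>a<d. \<Sum>b<d. (1 + (if a = b then 1 else 0)) / m)"
  proof (intro sum.cong refl)
    fix a b assume "a \<in> {..<d}" "b \<in> {..<d}"
    then have ab: "a < d" "b < d" by auto
    have "(\<Sum>j<n. \<Sum>k<n. (?c a b j k)\<^sup>2 + ?c a b j k * ?c a b k j) =
        (\<Sum>j<n. U $$ (j, a) * U $$ (j, a)) * (\<Sum>k<n. U $$ (k, b) * U $$ (k, b)) +
        (\<Sum>j<n. U $$ (j, a) * U $$ (j, b)) * (\<Sum>k<n. U $$ (k, a) * U $$ (k, b))"
      by (simp add: sum_product sum.distrib power2_eq_square mult_ac)
    also have "\<dots> = 1 + (if a = b then 1 else 0)"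
      using ab by (simp add: orthonormal_columnsD[OF U(2,1)])
    finally show "(\<Sum>j<n. \<Sum>k<n. (?c a b j k)\<^sup>2 + ?c a b j k * ?c a b k j) / m =
        (1 + (if a = b then 1 else 0)) / m" by simp
  qed
  also have "\<dots> = (real d ^ 2 + real d) / m"
    by (simp add: sum.distrib power2_eq_square sum_divide_distrib[symmetric] distrib_left)
  finally show "expectation F \<le> (real d ^ 2 + real d) / m" .
qed

end

section \<open>Markov bound and conclusion\<close>

theorem theorem3:
  fixes M :: "'w measure"
    and n d m :: nat
    and U :: "real mat"
    and \<epsilon> \<delta> :: real
    and h :: "nat \<Rightarrow> 'w \<Rightarrow> nat"
    and \<sigma> :: "nat \<Rightarrow> 'w \<Rightarrow> real"
  assumes "n \<ge> d" and "d \<ge> 1"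
    and "U \<in> carrier_mat n d" and "orthonormal_columns U"
    and "0 < \<epsilon>" and "\<epsilon> < 1"
    and "0 < \<delta>" and "\<delta> < 1"
    and "m > 0"
    and "real m \<ge> inverse \<delta> * (real d ^ 2 + real d) / (2 * \<epsilon> - \<epsilon> ^ 2) ^ 2"
    and "prob_space M"
    and "k_wise_independent_hash M 2 {..<n} {..<m} h"
    and "k_wise_independent_hash M 4 {..<n} {-1, 1} \<sigma>"
    and "independent_hashes M {..<n} {..<m} h {-1, 1} \<sigma>"
  shows "measure M {\<omega> \<in> space M.
           singular_values (sketch_matrix m n (\<lambda>j. h j \<omega>) (\<lambda>j. \<sigma> j \<omega>) * U)
             \<subseteq> {1 - \<epsilon> .. 1 + \<epsilon>}} \<ge> 1 - \<delta>"
proof -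
  interpret prob_space M by fact
  note hash = \<open>k_wise_independent_hash M 2 {..<n} {..<m} h\<close>
    and sign = \<open>k_wise_independent_hash M 4 {..<n} {-1, 1} \<sigma>\<close>
    and ind = \<open>independent_hashes M {..<n} {..<m} h {-1, 1} \<sigma>\<close>
    and U = \<open>U \<in> carrier_mat n d\<close> \<open>orthonormal_columns U\<close>
  define F where "F = (\<lambda>\<omega>. \<Sum>a<d. \<Sum>b<d. (\<Sum>j<n. \<Sum>k<n. U $$ (j, a) * U $$ (k, b) *
      collision_sign (\<lambda>j. h j \<omega>) (\<lambda>j. \<sigma> j \<omega>) j k)\<^sup>2)"
  \<comment> \<open>The threshold is squared because \<open>F\<close> will be the squared Frobenius
    norm of the deviation.\<close>
  define \<eta> where "\<eta> = (2 * \<epsilon> - \<epsilon>\<^sup>2)\<^sup>2"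
  let ?B = "\<lambda>\<omega>. sketch_matrix m n (\<lambda>j. h j \<omega>) (\<lambda>j. \<sigma> j \<omega>) * U"
  let ?S = "{\<omega> \<in> space M. singular_values (?B \<omega>) \<subseteq> {1 - \<epsilon>..1 + \<epsilon>}}"
  have intF: "integrable M F" and EF: "expectation F \<le> (real d ^ 2 + real d) / m"
    using expectation_gram_deviation[OF hash \<open>m > 0\<close> sign ind U] unfolding F_def by auto
  have [measurable]: "F \<in> borel_measurable M"
    using intF by simp
  have "\<epsilon> * \<epsilon> < 2 * \<epsilon>"
    using \<open>0 < \<epsilon>\<close> \<open>\<epsilon> < 1\<close> by simp
  then have "\<eta> > 0"
    unfolding \<eta>_def by (simp add: power2_eq_square)
  have "prob {\<omega> \<in> space M. F \<omega> \<ge> \<eta>} \<le> expectation F / \<eta>"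
    by (rule integral_Markov_inequality_measure[OF intF sets.top])
      (use \<open>\<eta> > 0\<close> in \<open>auto simp: F_def intro!: sum_nonneg AE_I2\<close>)
  also have "\<dots> \<le> \<delta>"
  proof -
    have "inverse \<delta> * (real d ^ 2 + real d) / \<eta> \<le> m"
      using \<open>real m \<ge> inverse \<delta> * (real d ^ 2 + real d) / (2 * \<epsilon> - \<epsilon> ^ 2) ^ 2\<close>
      unfolding \<eta>_def .
    then have "real d ^ 2 + real d \<le> \<delta> * \<eta> * m"
      using \<open>\<eta> > 0\<close> \<open>0 < \<delta>\<close> by (simp add: field_simps)
    then have "(real d ^ 2 + real d) / m \<le> \<delta> * \<eta>"
      using \<open>m > 0\<close> by (simp add: field_simps)
    with EF show ?thesis
      using \<open>\<eta> > 0\<close> by (simp add: field_simps)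
  qed
  finally have bad: "prob {\<omega> \<in> space M. F \<omega> \<ge> \<eta>} \<le> \<delta>" .
  \<comment> \<open>An inclusion is enough: singular values may lie in the interval even when
    \<open>F\<close> is large.\<close>
  have sub: "space M - {\<omega> \<in> space M. F \<omega> \<ge> \<eta>} \<subseteq> ?S"
  proof
    fix \<omega> assume "\<omega> \<in> space M - {\<omega> \<in> space M. F \<omega> \<ge> \<eta>}"
    then have \<omega>: "\<omega> \<in> space M" "F \<omega> \<le> \<eta>" by auto
    have "(mat_adjoint (?B \<omega>) * ?B \<omega>) $$ (a, b) = (if a = b then 1 else 0) +
        (\<Sum>j<n. \<Sum>k<n. U $$ (j, a) * U $$ (k, b) * collision_sign (\<lambda>j. h j \<omega>) (\<lambda>j. \<sigma> j \<omega>) j k)"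
      if "a < d" "b < d" for a b
      using hash_range[OF hash _ _ \<omega>(1)] hash_range[OF sign _ _ \<omega>(1)] that
      by (intro gram_sketch[OF U]) auto
    then have "(\<Sum>a<d. \<Sum>b<d. ((mat_adjoint (?B \<omega>) * ?B \<omega>) $$ (a, b) - (if a = b then 1 else 0))\<^sup>2) = F \<omega>"
      unfolding F_def by (intro sum.cong refl) auto
    with \<omega> have "singular_values (?B \<omega>) \<subseteq> {1 - \<epsilon>..1 + \<epsilon>}"
      unfolding \<eta>_def using U \<open>0 < \<epsilon>\<close> \<open>\<epsilon> < 1\<close>
      by (intro singular_values_subset[of _ m d]) (auto simp: sketch_matrix_def)
    with \<omega> show "\<omega> \<in> ?S" by simp
  qed
  \<comment> \<open>The sketch reads both functions only below \<open>n\<close>, so it depends on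
    the restricted tuples alone. This makes \<open>?S\<close> an event, as monotonicity of the
    probability requires.\<close>
  have "sketch_matrix m n (\<lambda>x\<in>{..<n}. h x \<omega>) (\<lambda>x\<in>{..<n}. \<sigma> x \<omega>) =
      sketch_matrix m n (\<lambda>j. h j \<omega>) (\<lambda>j. \<sigma> j \<omega>)" for \<omega>
    unfolding sketch_matrix_def by (intro eq_matI) auto
  then have "?S \<in> events"
    using hash_tuple_pair_event[OF hash _ sign, where
        P = "\<lambda>f g. singular_values (sketch_matrix m n f g * U) \<subseteq> {1 - \<epsilon>..1 + \<epsilon>}"]
    by simp
  then have "prob (space M - {\<omega> \<in> space M. F \<omega> \<ge> \<eta>}) \<le> prob ?S"
    using sub by (intro finite_measure_mono)
  moreover have "prob (space M - {\<omega> \<in> space M. F \<omega> \<ge> \<eta>}) = 1 - prob {\<omega> \<in> space M. F \<omega> \<ge> \<eta>}"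
    by (intro prob_compl) measurable
  ultimately show ?thesis using bad by linarith
qed

end
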